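(* Let $q$ be a prime power, let $d$ be a positive integer, and let $k \in \{1,2,\ldots,d-1\}$. Let $E \subset \mathbb{F}_q^d$ be a set with $q^{k-1} \leq |E| \leq 100^{-1}q^k$. Then $$\#\{y \in \mathbb{F}_q^d : |\pi^y(E)| \leq 50^{-1}|E|\} \leq 40q^k.$$
   Context: $\mathbb{F}_q$ denotes the finite field with $q$ elements and $\mathbb{F}_q^d$ the $d$-dimensional vector space over it. A line is an affine line (a translate of a $1$-dimensional linear subspace of $\mathbb{F}_q^d$). For a point $y \in \mathbb{F}_q^d$, the radial projection $\pi^y$ maps each point $x \in \mathbb{F}_q^d \setminus \{y\}$ to the unique line containing $x$ and $y$. For a set $E \subset \mathbb{F}_q^d$, $\pi^y(E)$ denotes the set of lines $\{\pi^y(x) : x \in E \setminus \{y\}\}$, and $|\pi^y(E)|$ is the number of distinct lines in this set (i.e. the number of lines through $y$ that contain at least one point of $E$ other than $y$). *)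

theory Defs
  imports "HOL-Analysis.Analysis"
begin

(* The library's affine notions are restricted to real vector spaces; vec.subspace and
   vec.dim are the linear notions for vectors over an arbitrary field. *)
definition is_line :: "('a::field ^ 'n) set \<Rightarrow> bool" where
  "is_line L \<longleftrightarrow> (\<exists>a V. vec.subspace V \<and> vec.dim V = 1 \<and> L = (\<lambda>v. a + v) ` V)"

(* Meaningful only for x distinct from y; see ex1_line. *)
definition line_proj :: "'a::field ^ 'n \<Rightarrow> 'a ^ 'n \<Rightarrow> ('a ^ 'n) set" where
  "line_proj y x = (THE L. is_line L \<and> x \<in> L \<and> y \<in> L)"

definition radial_proj :: "'a::field ^ 'n \<Rightarrow> ('a ^ 'n) set \<Rightarrow> ('a ^ 'n) set set" where
  "radial_proj y E = line_proj y ` (E - {y})"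

lemma dim_1_subspace_eq_span:
  fixes V :: "('a::field ^ 'n) set"
  assumes V: "vec.subspace V" "vec.dim V = 1" and w: "w \<in> V" "w \<noteq> 0"
  shows "V = vec.span {w}"
proof -
  have "vec.span {w} \<subseteq> V"
    using V(1) w(1) by (simp add: vec.span_minimal)
  moreover have "vec.dim (vec.span {w}) = 1"
    using w(2) vec.dim_eq_card_independent[of "{w}"] by (simp add: vec.dim_span)
  ultimately show ?thesis
    using vec.subspace_dim_equal[of "vec.span {w}" V] V by simp
qed

lemma ex1_line:
  fixes x y :: "'a::field ^ 'n"
  assumes "x \<noteq> y"
  shows "\<exists>!L. is_line L \<and> x \<in> L \<and> y \<in> L"
proof (rule ex1I)
  let ?V = "vec.span {x - y}"
  have nz: "x - y \<noteq> 0" using assms by simp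
  have "vec.dim ?V = 1"
    using nz vec.dim_eq_card_independent[of "{x - y}"] by (simp add: vec.dim_span)
  then have "is_line ((\<lambda>v. y + v) ` ?V)"
    unfolding is_line_def using vec.subspace_span by blast
  moreover have "x \<in> (\<lambda>v. y + v) ` ?V"
    by (rule image_eqI[of _ _ "x - y"]) (simp_all add: vec.span_base)
  moreover have "y \<in> (\<lambda>v. y + v) ` ?V"
    by (rule image_eqI[of _ _ 0]) (simp_all add: vec.span_zero)
  ultimately show "is_line ((\<lambda>v. y + v) ` ?V) \<and> x \<in> (\<lambda>v. y + v) ` ?V \<and> y \<in> (\<lambda>v. y + v) ` ?V"
    by blast
  fix L assume L: "is_line L \<and> x \<in> L \<and> y \<in> L"
  then obtain a V where V: "vec.subspace V" "vec.dim V = 1" and La: "L = (\<lambda>v. a + v) ` V"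
    unfolding is_line_def by blast
  obtain u v where u: "u \<in> V" "x = a + u" and v: "v \<in> V" "y = a + v"
    using L La by blast
  have "x - y \<in> V"
    using vec.subspace_diff[OF V(1) u(1) v(1)] u v by simp
  then have VV: "V = ?V"
    using dim_1_subspace_eq_span[OF V _ nz] by blast
  show "L = (\<lambda>v. y + v) ` ?V"
  proof
    show "L \<subseteq> (\<lambda>v. y + v) ` ?V"
    proof
      fix z assume "z \<in> L"
      then obtain w where w: "w \<in> V" "z = a + w" using La by blast
      show "z \<in> (\<lambda>v. y + v) ` ?V"
        by (rule image_eqI[of _ _ "w - v"])
           (use w v VV vec.subspace_diff[OF V(1) w(1) v(1)] in auto)
    qed
    show "(\<lambda>v. y + v) ` ?V \<subseteq> L"
    proof
      fix z assume "z \<in> (\<lambda>v. y + v) ` ?V"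
      then obtain w where w: "w \<in> V" "z = y + w" using VV by blast
      show "z \<in> L" unfolding La
        by (rule image_eqI[of _ _ "v + w"])
           (use w v vec.subspace_add[OF V(1) v(1) w(1)] in \<open>auto simp: add.assoc\<close>)
    qed
  qed
qed

end

theory Submission
  imports Defs
begin

text \<open>
  Call a line rich if it meets \<open>E\<close> in at least ten points. A point \<open>y\<close> outside \<open>E\<close> with a small
  projection sees a positive proportion of \<open>E\<close> on rich lines. The rich lines
  \<open>L\<close> satisfy \<open>\<Sum> |E \<inter> L|\<^sup>2 = O(|E|\<^sup>2)\<close>, without the diagonal term that would come from poor lines.
  In dimension \<open>k + 1\<close> Cauchy--Schwarz against the variance of \<open>|F \<inter> L|\<close> over all lines (the lines
  form a 2-design) then bounds a set \<open>F\<close> of such points by \<open>O(q\<^sup>k)\<close>.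

  A random matrix with \<open>k + 1\<close> nonzero rows reduces dimension \<open>d\<close> to this case: it is
  pairwise independent, so it is almost injective both on \<open>E\<close> and on a set of \<open>10 q\<^sup>k\<close>
  exceptional points once \<open>q \<ge> 50\<close>, and it does not enlarge radial projections. For \<open>q < 50\<close>
  every exceptional point lies in \<open>E\<close>, because a line has only \<open>q\<close> points.
\<close>

section \<open>Counting and variance in a linear space with constant block size\<close>

locale finite_linear_space =
  fixes X :: "'p set" and B :: "'p set set" and q :: nat
  assumes finite_points: "finite X"
    and block_subset: "L \<in> B \<Longrightarrow> L \<subseteq> X"
    and card_block: "L \<in> B \<Longrightarrow> card L = q"
    and block_size: "2 \<le> q"
    and block_size_le: "q \<le> card X"
    and ex1_block: "x \<in> X \<Longrightarrow> y \<in> X \<Longrightarrow> x \<noteq> y \<Longrightarrow> \<exists>!L. L \<in> B \<and> x \<in> L \<and> y \<in> L"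
begin

text \<open>The number of blocks through a point.\<close>

definition repl :: real where
  "repl = (real (card X) - 1) / (real q - 1)"

lemma finite_blocks: "finite B"
  by (rule finite_subset[of _ "Pow X"]) (use block_subset finite_points in auto)

lemma finite_subset_points: "S \<subseteq> X \<Longrightarrow> finite S"
  using finite_points finite_subset by blast

lemma repl_nonneg: "0 \<le> repl"
  unfolding repl_def using block_size block_size_le by simp

text \<open>The blocks through \<open>x\<close>, with \<open>x\<close> removed, partition the other
  points into classes of size \<open>q - 1\<close>.\<close>

lemma card_blocks_through:
  assumes x: "x \<in> X"
  shows "real (card {L \<in> B. x \<in> L}) = repl"
proof -
  let ?Bx = "{L \<in> B. x \<in> L}"
  have eq: "X - {x} = (\<Union>L\<in>?Bx. L - {x})"
    using ex1_block[OF x] block_subset by fastforce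
  have "card (X - {x}) = (\<Sum>L\<in>?Bx. card (L - {x}))"
    unfolding eq
  proof (rule card_UN_disjoint)
    show "finite ?Bx" using finite_blocks by simp
    show "\<forall>L\<in>?Bx. finite (L - {x})"
      using block_subset finite_subset_points by blast
    show "\<forall>L\<in>?Bx. \<forall>L'\<in>?Bx. L \<noteq> L' \<longrightarrow> (L - {x}) \<inter> (L' - {x}) = {}"
      using ex1_block[OF x] block_subset by fastforce
  qed
  also have "\<dots> = (\<Sum>L\<in>?Bx. q - 1)"
    using card_block by (intro sum.cong) (auto simp: card_Diff_singleton)
  finally have "card X - 1 = card ?Bx * (q - 1)"
    using x finite_points by (simp add: card_Diff_singleton)
  then have "real (card X - 1) = real (card ?Bx) * real (q - 1)"
    by (metis of_nat_mult)
  then have "real (card X) - 1 = real (card ?Bx) * (real q - 1)"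
    using block_size block_size_le by (simp add: of_nat_diff)
  then show ?thesis
    unfolding repl_def using block_size by (simp add: field_simps)
qed

lemma sum_incidences:
  fixes g :: "'p set \<Rightarrow> real"
  assumes S: "S \<subseteq> X"
  shows "(\<Sum>y\<in>S. \<Sum>L\<in>{L \<in> B. y \<in> L}. g L) = (\<Sum>L\<in>B. real (card (S \<inter> L)) * g L)"
proof -
  note fin = finite_blocks finite_subset_points[OF S]
  have "(\<Sum>y\<in>S. \<Sum>L\<in>{L \<in> B. y \<in> L}. g L) = (\<Sum>L\<in>B. \<Sum>y\<in>{y \<in> S. y \<in> L}. g L)"
    by (rule sum.swap_restrict) (use fin in auto)
  also have "\<dots> = (\<Sum>L\<in>B. real (card (S \<inter> L)) * g L)"
    by (intro sum.cong) (auto simp: Int_def)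
  finally show ?thesis .
qed

lemma sum_card_inter:
  assumes S: "S \<subseteq> X"
  shows "(\<Sum>L\<in>B. real (card (S \<inter> L))) = real (card S) * repl"
  using sum_incidences[OF S, of "\<lambda>_. 1"] card_blocks_through S
  by (simp add: subset_iff)

lemma card_blocks: "real (card B) * real q = real (card X) * repl"
  using sum_card_inter[of X] block_subset card_block
  by (simp add: Int_absorb1)

text \<open>The square counts pairs of points of \<open>S\<close> on a common block: a diagonal pair
  lies on \<open>repl\<close> blocks, any other pair on exactly one.\<close>

lemma sum_card_inter_sq:
  assumes S: "S \<subseteq> X"
  shows "(\<Sum>L\<in>B. (real (card (S \<inter> L)))\<^sup>2)
           = real (card S) * repl + (real (card S))\<^sup>2 - real (card S)"
proof -
  have fS: "finite S" using finite_subset_points[OF S] .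
  have one: "(\<Sum>L\<in>{L \<in> B. y \<in> L}. real (card (S \<inter> L))) = repl + (real (card S) - 1)"
    if y: "y \<in> S" for y
  proof -
    have "(\<Sum>L\<in>{L \<in> B. y \<in> L}. real (card (S \<inter> L)))
        = (\<Sum>L\<in>{L \<in> B. y \<in> L}. \<Sum>x\<in>{x \<in> S. x \<in> L}. 1)"
      by (intro sum.cong) (auto simp: Int_def)
    also have "\<dots> = (\<Sum>x\<in>S. \<Sum>L\<in>{L \<in> {L \<in> B. y \<in> L}. x \<in> L}. 1)"
      by (rule sum.swap_restrict[symmetric]) (use finite_blocks fS in auto)
    also have "\<dots> = (\<Sum>x\<in>S. if x = y then repl else 1)"
    proof (rule sum.cong)
      fix x assume x: "x \<in> S"
      show "(\<Sum>L\<in>{L \<in> {L \<in> B. y \<in> L}. x \<in> L}. 1) = (if x = y then repl else 1)"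
      proof (cases "x = y")
        case True
        then show ?thesis using card_blocks_through[of y] y S by auto
      next
        case False
        obtain L where "L \<in> B" "x \<in> L" "y \<in> L" and "\<And>L'. L' \<in> B \<and> x \<in> L' \<and> y \<in> L' \<Longrightarrow> L' = L"
          using ex1_block[of x y] x y S False by blast
        then have "{L \<in> {L \<in> B. y \<in> L}. x \<in> L} = {L}" by blast
        then show ?thesis using False by simp
      qed
    qed simp
    also have "\<dots> = repl + (\<Sum>x\<in>S - {y}. 1)"
      using y fS by (simp add: sum.remove[of S y])
    also have "(\<Sum>x\<in>S - {y}. 1::real) = real (card S) - 1"
      using y fS card_gt_0_iff[of S] by (auto simp: card_Diff_singleton of_nat_diff)
    finally show ?thesis .
  qed
  have "(\<Sum>L\<in>B. (real (card (S \<inter> L)))\<^sup>2) = (\<Sum>y\<in>S. repl + (real (card S) - 1))"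
    using sum_incidences[OF S, of "\<lambda>L. real (card (S \<inter> L))"] one
    by (simp add: power2_eq_square)
  then show ?thesis by (simp add: algebra_simps power2_eq_square)
qed

text \<open>The subtracted number is the mean of \<open>card (S \<inter> L)\<close> over all blocks.
  Expanding the square by the first two moments leaves \<open>m * repl - m\<close> plus a multiple
  of \<open>m\<^sup>2\<close> whose coefficient is nonpositive, because
  \<open>q \<le> card X\<close> gives \<open>q * repl \<ge> card X\<close>.\<close>

lemma variance_card_inter:
  assumes S: "S \<subseteq> X"
  shows "(\<Sum>L\<in>B. (real (card (S \<inter> L)) - real (card S) * real q / real (card X))\<^sup>2)
           \<le> real (card S) * repl"
proof -
  define m v \<mu> where "m = real (card S)" and "v = real (card X)" and "\<mu> = m * real q / v"
  have v: "v > 0" and qv: "real q \<le> v" and q: "real q \<ge> 2"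
    using block_size block_size_le by (auto simp: v_def)
  have "(\<Sum>L\<in>B. (real (card (S \<inter> L)) - \<mu>)\<^sup>2)
      = (\<Sum>L\<in>B. (real (card (S \<inter> L)))\<^sup>2) - 2 * \<mu> * (\<Sum>L\<in>B. real (card (S \<inter> L))) + real (card B) * \<mu>\<^sup>2"
    by (simp add: power2_diff sum.distrib sum_subtractf sum_distrib_left algebra_simps)
  also have "\<dots> = m * repl + m\<^sup>2 - m - 2 * \<mu> * (m * repl) + real (card B) * \<mu>\<^sup>2"
    by (simp add: sum_card_inter[OF S] sum_card_inter_sq[OF S] m_def)
  \<comment> \<open>By \<open>card_blocks\<close>, the constant term cancels one of the two copies
    of the cross term.\<close>
  also have "real (card B) * \<mu>\<^sup>2 = \<mu> * (m * repl)"
  proof -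
    have "real (card B) * \<mu>\<^sup>2 = (real (card B) * real q) * (m / v) * \<mu>"
      by (simp add: \<mu>_def power2_eq_square)
    also have "\<dots> = \<mu> * (m * repl)"
      unfolding card_blocks using v by (simp add: v_def)
    finally show ?thesis .
  qed
  also have "m * repl + m\<^sup>2 - m - 2 * \<mu> * (m * repl) + \<mu> * (m * repl)
      = m * repl - m + m\<^sup>2 * (1 - real q * repl / v)"
    using v by (simp add: \<mu>_def field_simps power2_eq_square)
  also have "\<dots> \<le> m * repl"
  proof -
    have "v * (real q - 1) \<le> real q * (v - 1)" using qv by (simp add: algebra_simps)
    then have "1 \<le> real q * repl / v"
      unfolding repl_def v_def[symmetric] using v q by (simp add: field_simps)
    then have "m\<^sup>2 * (1 - real q * repl / v) \<le> 0"
      by (intro mult_nonneg_nonpos) auto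
    then show ?thesis by (simp add: m_def)
  qed
  finally show ?thesis by (simp add: \<mu>_def m_def v_def)
qed

section \<open>Rich blocks and points with a small projection\<close>

lemma sum_rich_blocks_ge:
  assumes E: "E \<subseteq> X" and y: "y \<in> X - E"
  shows "real (card E) - 9 * real (card {L \<in> B. y \<in> L \<and> E \<inter> L \<noteq> {}})
           \<le> (\<Sum>L\<in>{L \<in> B. y \<in> L}. if 10 \<le> card (E \<inter> L) then real (card (E \<inter> L)) else 0)"
    (is "_ \<le> (\<Sum>L\<in>?By. ?g L)")
proof -
  have fE: "finite E" using finite_subset_points[OF E] .
  have fB: "finite ?By" using finite_blocks by simp
  have "E \<subseteq> (\<Union>L\<in>?By. E \<inter> L)"
  proof
    fix x assume "x \<in> E"
    then show "x \<in> (\<Union>L\<in>?By. E \<inter> L)" using ex1_block[of x y] E y by auto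
  qed
  then have "card E \<le> (\<Sum>L\<in>?By. card (E \<inter> L))"
    using card_mono[of "\<Union>L\<in>?By. E \<inter> L" E] card_UN_le[OF fB, of "\<lambda>L. E \<inter> L"] fB fE
    by (meson finite_Int finite_UN_I le_trans)
  then have "real (card E) \<le> (\<Sum>L\<in>?By. real (card (E \<inter> L)))"
    by (metis of_nat_le_iff of_nat_sum)
  \<comment> \<open>A block that is not rich carries at most 9 points of \<open>E\<close>, so
    discarding it costs at most 9, and only if it meets \<open>E\<close> at all.\<close>
  also have "\<dots> \<le> (\<Sum>L\<in>?By. ?g L + (if E \<inter> L \<noteq> {} then 9 else 0))"
    by (intro sum_mono) auto
  also have "\<dots> = (\<Sum>L\<in>?By. ?g L) + 9 * real (card {L \<in> ?By. E \<inter> L \<noteq> {}})"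
    using fB by (simp add: sum.distrib sum.If_cases Int_def)
  also have "{L \<in> ?By. E \<inter> L \<noteq> {}} = {L \<in> B. y \<in> L \<and> E \<inter> L \<noteq> {}}" by auto
  finally show ?thesis by simp
qed

text \<open>Points of \<open>F\<close> lie on rich blocks that together carry much of
  \<open>E\<close>, while sparsity keeps the average contribution of the rich blocks small. The
  excess is a correlation of \<open>f - \<mu>\<close> with \<open>g\<close>, which Cauchy-Schwarz
  limits. The factor 49 rather than 50 leaves room for a set \<open>E\<close> that has shrunk
  slightly under a projection.\<close>

lemma card_low_projection_points:
  assumes E: "E \<subseteq> X" "E \<noteq> {}" and sparse: "100 * (real q * real (card E)) \<le> real (card X)"
    and F: "F \<subseteq> X - E"
    and low: "\<And>y. y \<in> F \<Longrightarrow> 49 * real (card {L \<in> B. y \<in> L \<and> E \<inter> L \<noteq> {}}) \<le> real (card E)"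
  shows "real (card F) \<le> 2 * repl"
proof (cases "F = {}")
  case True
  then show ?thesis using repl_nonneg by simp
next
  case False
  define m n v where "m = real (card F)" and "n = real (card E)" and "v = real (card X)"
  define \<mu> where "\<mu> = m * real q / v"
  define e where "e = (\<lambda>L. real (card (E \<inter> L)))"
  define f where "f = (\<lambda>L. real (card (F \<inter> L)))"
  define g where "g = (\<lambda>L. if 10 \<le> card (E \<inter> L) then real (card (E \<inter> L)) else 0)"
  have FX: "F \<subseteq> X" using F by blast
  have n: "n > 0" and m: "m > 0" and v: "v > 0"
    using E False finite_subset_points[OF E(1)] finite_subset_points[OF FX] finite_points
    by (auto simp: n_def m_def v_def card_gt_0_iff)
  \<comment> \<open>Ordered pairs of distinct points of \<open>E\<close>, each on one block.
    Dropping the diagonal here is what keeps \<open>repl\<close> out of the moments of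
    \<open>g\<close>.\<close>
  have pairs: "(\<Sum>L\<in>B. e L * (e L - 1)) = n\<^sup>2 - n"
    using sum_card_inter[OF E(1)] sum_card_inter_sq[OF E(1)]
    by (simp add: e_def n_def algebra_simps sum_subtractf power2_eq_square)
  have g1: "9 * g L \<le> e L * (e L - 1)" for L
  proof (cases "10 \<le> card (E \<inter> L)")
    case True
    then have "e L * 9 \<le> e L * (e L - 1)" by (intro mult_left_mono) (auto simp: e_def)
    then show ?thesis using True by (simp add: g_def e_def)
  next
    case False
    then show ?thesis by (cases "card (E \<inter> L)") (auto simp: g_def e_def)
  qed
  \<comment> \<open>For \<open>e \<ge> 10\<close> this is the inequality
    \<open>9 * e \<le> 10 * (e - 1)\<close>. Below 10 the left side vanishes and
    \<open>e * (e - 1) \<ge> 0\<close> because \<open>e\<close> is a natural number.\<close>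
  have g2: "9 * (g L)\<^sup>2 \<le> 10 * (e L * (e L - 1))" for L
  proof (cases "10 \<le> card (E \<inter> L)")
    case True
    then have "e L * 10 \<le> e L * e L" by (intro mult_left_mono) (auto simp: e_def)
    then show ?thesis using True by (simp add: g_def e_def power2_eq_square algebra_simps)
  next
    case False
    then show ?thesis by (cases "card (E \<inter> L)") (auto simp: g_def e_def)
  qed
  have G1: "9 * (\<Sum>L\<in>B. g L) \<le> n\<^sup>2"
    using sum_mono[of B "\<lambda>L. 9 * g L", OF g1] pairs n by (simp add: sum_distrib_left)
  have G2: "9 * (\<Sum>L\<in>B. (g L)\<^sup>2) \<le> 10 * n\<^sup>2"
    using sum_mono[of B "\<lambda>L. 9 * (g L)\<^sup>2", OF g2] pairs n
    by (simp add: sum_distrib_left[symmetric])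
  \<comment> \<open>Here \<open>40 / 49 = 1 - 9 / 49\<close>: at most \<open>n / 49\<close> blocks
    through \<open>y\<close> meet \<open>E\<close>, and each loses at most 9 points.\<close>
  have "m * (40 / 49 * n) = (\<Sum>y\<in>F. 40 / 49 * n)" by (simp add: m_def)
  also have "\<dots> \<le> (\<Sum>y\<in>F. \<Sum>L\<in>{L \<in> B. y \<in> L}. g L)"
  proof (rule sum_mono)
    fix y assume y: "y \<in> F"
    show "40 / 49 * n \<le> (\<Sum>L\<in>{L \<in> B. y \<in> L}. g L)"
      using sum_rich_blocks_ge[OF E(1), of y] low[OF y] y F by (auto simp: g_def n_def)
  qed
  also have "\<dots> = (\<Sum>L\<in>B. f L * g L)"
    using sum_incidences[OF FX] by (simp add: f_def)
  finally have lower: "m * (40 / 49 * n) \<le> (\<Sum>L\<in>B. f L * g L)" .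
  have "\<mu> * (\<Sum>L\<in>B. g L) \<le> \<mu> * (n\<^sup>2 / 9)"
    using G1 m v by (intro mult_left_mono) (auto simp: \<mu>_def)
  also have "\<dots> = m * n / 9 * (real q * n / v)"
    by (simp add: \<mu>_def power2_eq_square mult_ac)
  also have "\<dots> \<le> m * n / 9 * (1 / 100)"
    using sparse m n v by (intro mult_left_mono) (auto simp: n_def v_def field_simps)
  finally have main: "\<mu> * (\<Sum>L\<in>B. g L) \<le> m * n / 900" by simp
  \<comment> \<open>Numerically, \<open>40 / 49 - 1 / 900 > 4 / 5\<close>.\<close>
  have "(4 / 5) * (m * n) \<le> (\<Sum>L\<in>B. (f L - \<mu>) * g L)"
    using lower main mult_pos_pos[OF m n]
    by (simp add: left_diff_distrib sum_subtractf sum_distrib_left)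
  then have "((4 / 5) * (m * n))\<^sup>2 \<le> (\<Sum>L\<in>B. (f L - \<mu>) * g L)\<^sup>2"
    using m n by (intro power_mono) auto
  also have "\<dots> \<le> (\<Sum>L\<in>B. (f L - \<mu>)\<^sup>2) * (\<Sum>L\<in>B. (g L)\<^sup>2)"
    by (rule Cauchy_Schwarz_ineq_sum)
  also have "\<dots> \<le> (m * repl) * (10 / 9 * n\<^sup>2)"
    using variance_card_inter[OF FX] G2 m repl_nonneg
    by (intro mult_mono) (auto simp: f_def \<mu>_def m_def v_def sum_nonneg)
  finally have "(m * n\<^sup>2) * (16 / 25 * m) \<le> (m * n\<^sup>2) * (10 / 9 * repl)"
    by (simp add: power2_eq_square algebra_simps)
  \<comment> \<open>This gives \<open>m \<le> 125 / 72 * repl\<close>, and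
    \<open>125 / 72 < 2\<close>.\<close>
  then have "16 / 25 * m \<le> 10 / 9 * repl"
    using m n by (simp add: mult_le_cancel_left_pos)
  then show ?thesis using repl_nonneg by (simp add: m_def)
qed

end

section \<open>Parametrized lines and their linear images\<close>

definition param_line :: "'a::field ^ 'n \<Rightarrow> 'a ^ 'n \<Rightarrow> ('a ^ 'n) set" where
  "param_line y x = range (\<lambda>c. y + c *s (x - y))"

lemma left_mem_param_line [simp]: "y \<in> param_line y x"
  unfolding param_line_def by (rule image_eqI[of _ _ 0]) auto

lemma right_mem_param_line [simp]: "x \<in> param_line y x"
  unfolding param_line_def by (rule image_eqI[of _ _ 1]) auto

lemma line_proj_eq:
  fixes x y :: "'a::field ^ 'n"
  assumes "x \<noteq> y"
  shows "line_proj y x = param_line y x"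
proof -
  have nz: "x - y \<noteq> 0" using assms by simp
  have "vec.dim (vec.span {x - y}) = 1"
    using nz vec.dim_eq_card_independent[of "{x - y}"] by (simp add: vec.dim_span)
  moreover have "param_line y x = (\<lambda>v. y + v) ` vec.span {x - y}"
    by (auto simp: param_line_def vec.span_singleton image_image)
  ultimately have "is_line (param_line y x)"
    unfolding is_line_def using vec.subspace_span by blast
  then show ?thesis
    unfolding line_proj_def using ex1_line[OF assms] by (intro the1_equality) auto
qed

lemma card_param_line:
  fixes x y :: "'a::{field,finite} ^ 'n"
  assumes "x \<noteq> y"
  shows "card (param_line y x) = CARD('a)"
proof -
  have "inj (\<lambda>c. y + c *s (x - y))"
    using assms by (auto simp: inj_def simp del: vector_ssub_ldistrib)
  then show ?thesis unfolding param_line_def by (simp add: card_image)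
qed

text \<open>If \<open>x\<close> and \<open>y\<close> have parameters \<open>s\<close> and
  \<open>t\<close>, then \<open>c \<mapsto> t + c * (s - t)\<close> is an invertible change of
  parameter.\<close>

lemma param_line_unique:
  fixes a b x y :: "'a::field ^ 'n"
  assumes "x \<in> param_line a b" "y \<in> param_line a b" "x \<noteq> y"
  shows "param_line a b = param_line y x"
proof -
  obtain s t where s: "x = a + s *s (b - a)" and t: "y = a + t *s (b - a)"
    using assms(1,2) by (auto simp: param_line_def)
  have st: "s - t \<noteq> 0" using assms(3) s t by auto
  have xy: "x - y = (s - t) *s (b - a)"
    by (simp add: s t vector_sub_rdistrib)
  have 1: "y + c *s (x - y) = a + (t + c * (s - t)) *s (b - a)" for c
    unfolding xy by (simp add: t vec_eq_iff algebra_simps)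
  have 2: "a + c *s (b - a) = y + ((c - t) / (s - t)) *s (x - y)" for c
    unfolding 1 using st by simp
  show ?thesis
  proof (intro equalityI subsetI)
    fix z assume "z \<in> param_line a b"
    then obtain c where "z = a + c *s (b - a)" unfolding param_line_def by (elim rangeE)
    then show "z \<in> param_line y x" unfolding param_line_def 2 by (rule range_eqI)
  next
    fix z assume "z \<in> param_line y x"
    then obtain c where "z = y + c *s (x - y)" unfolding param_line_def by (elim rangeE)
    then show "z \<in> param_line a b" unfolding param_line_def 1 by (rule range_eqI)
  qed
qed

lemma matrix_image_param_line:
  fixes A :: "'a::field ^ 'n ^ 'm"
  shows "(\<lambda>x. A *v x) ` param_line y x = param_line (A *v y) (A *v x)"
  unfolding param_line_def image_image
  by (simp add: matrix_vector_right_distrib matrix_vector_mult_diff_distrib vector_scalar_commute)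

section \<open>Coordinate subspaces and matrices mapping into them\<close>

definition coord_space :: "'n set \<Rightarrow> ('a::field ^ 'n) set" where
  "coord_space I = {x. \<forall>i. i \<notin> I \<longrightarrow> x $ i = 0}"

text \<open>These matrices are the linear maps into \<open>coord_space I\<close>. A coordinate
  subspace serves as the target because its dimension \<open>k + 1\<close> is a number and not a
  type.\<close>

definition coord_matrices :: "'m set \<Rightarrow> ('a::field ^ 'n ^ 'm) set" where
  "coord_matrices I = {A. \<forall>i. i \<notin> I \<longrightarrow> A $ i = 0}"

lemma card_coord_space:
  "card (coord_space I :: ('a::{field,finite} ^ 'n) set) = CARD('a) ^ card I"
proof -
  have "bij_betw (\<lambda>x. restrict (($) x) I) (coord_space I :: ('a ^ 'n) set) (I \<rightarrow>\<^sub>E UNIV)"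
  proof (rule bij_betw_byWitness[where f' = "\<lambda>h. \<chi> i. if i \<in> I then h i else 0"])
    show "\<forall>x\<in>coord_space I. (\<chi> i. if i \<in> I then restrict (($) x) I i else 0) = (x :: 'a ^ 'n)"
      by (auto simp: coord_space_def vec_eq_iff)
    show "\<forall>h\<in>I \<rightarrow>\<^sub>E UNIV. restrict (($) ((\<chi> i. if i \<in> I then h i else 0) :: 'a ^ 'n)) I = h"
      by (auto simp: fun_eq_iff PiE_def extensional_def)
  qed (auto simp: coord_space_def)
  then show ?thesis
    using bij_betw_same_card card_funcsetE[of I "UNIV :: 'a set"] by fastforce
qed

lemma coord_matrices_mult: "A \<in> coord_matrices I \<Longrightarrow> A *v x \<in> coord_space I"
  by (auto simp: coord_matrices_def coord_space_def matrix_vector_mult_def)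

lemma coord_space_line_subset:
  "x \<in> coord_space I \<Longrightarrow> y \<in> coord_space I \<Longrightarrow> param_line y x \<subseteq> coord_space I"
  by (auto simp: coord_space_def param_line_def)

lemma finite_linear_space_coord_space:
  assumes "I \<noteq> {}"
  shows "finite_linear_space (coord_space I :: ('a::{field,finite} ^ 'n) set)
           {param_line y x | x y. x \<in> coord_space I \<and> y \<in> coord_space I \<and> x \<noteq> y} CARD('a)"
proof
  have "card {0, 1 :: 'a} \<le> CARD('a)" by (rule card_mono) auto
  then show "2 \<le> CARD('a)" by simp
  have "CARD('a) ^ 1 \<le> CARD('a) ^ card I"
    using assms by (intro power_increasing) (auto simp: Suc_le_eq card_gt_0_iff)
  then show "CARD('a) \<le> card (coord_space I :: ('a ^ 'n) set)"
    by (simp add: card_coord_space)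
next
  fix x y :: "'a ^ 'n"
  assume "x \<in> coord_space I" "y \<in> coord_space I" "x \<noteq> y"
  then show "\<exists>!L. L \<in> {param_line y x | x y. x \<in> coord_space I \<and> y \<in> coord_space I \<and> x \<noteq> y}
      \<and> x \<in> L \<and> y \<in> L"
    by (intro ex1I[of _ "param_line y x"]) (auto dest: param_line_unique)
qed (use coord_space_line_subset card_param_line in \<open>auto\<close>)

text \<open>For a uniformly random matrix, \<open>A *v u\<close> is uniform on
  \<open>coord_space I\<close>, hence zero with probability \<open>1 / q ^ card I\<close>. With
  \<open>u = x - x'\<close> this is the collision probability of two distinct points.\<close>

lemma card_coord_matrices_kernel:
  fixes u :: "'a::{field,finite} ^ 'n"
  assumes u: "u \<noteq> 0"
  shows "card {A \<in> coord_matrices I :: ('a ^ 'n ^ 'm) set. A *v u = 0} * CARD('a) ^ card I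
           = card (coord_matrices I :: ('a ^ 'n ^ 'm) set)"
proof -
  obtain j where j: "u $ j \<noteq> 0" using u by (auto simp: vec_eq_iff)
  \<comment> \<open>a linear section of \<open>A \<mapsto> A *v u\<close>, so that all fibres are translates of the kernel\<close>
  define C :: "'a ^ 'm \<Rightarrow> 'a ^ 'n ^ 'm"
    where "C = (\<lambda>w. \<chi> i l. if l = j then w $ i / u $ j else 0)"
  have Cu: "C w *v u = w" for w
    using j by (simp add: C_def matrix_vector_mult_def vec_eq_iff if_distrib[of "\<lambda>x. x * _"] cong: if_cong)
  have CM: "C w \<in> coord_matrices I" if "w \<in> coord_space I" for w
    using that by (auto simp: C_def coord_matrices_def coord_space_def vec_eq_iff)
  let ?K = "{A \<in> coord_matrices I. A *v u = 0}"
  have "bij_betw (\<lambda>(A, w). A + C w) (?K \<times> coord_space I) (coord_matrices I)"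
  proof (rule bij_betw_byWitness[where f' = "\<lambda>A. (A - C (A *v u), A *v u)"])
    show "\<forall>p\<in>?K \<times> coord_space I. (\<lambda>A. (A - C (A *v u), A *v u)) ((\<lambda>(A, w). A + C w) p) = p"
      by (auto simp: matrix_vector_mult_add_rdistrib Cu)
    show "(\<lambda>(A, w). A + C w) ` (?K \<times> coord_space I) \<subseteq> coord_matrices I"
      using CM by (auto simp: coord_matrices_def)
    show "(\<lambda>A. (A - C (A *v u), A *v u)) ` coord_matrices I \<subseteq> ?K \<times> coord_space I"
    proof -
      have "A - C (A *v u) \<in> coord_matrices I" if "A \<in> coord_matrices I" for A
        using CM[OF coord_matrices_mult[OF that, of u]] that by (auto simp: coord_matrices_def)
      then show ?thesis
        using coord_matrices_mult by (auto simp: matrix_vector_mult_diff_rdistrib Cu)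
    qed
  qed auto
  then have "card (?K \<times> (coord_space I :: ('a ^ 'm) set)) = card (coord_matrices I :: ('a ^ 'n ^ 'm) set)"
    by (rule bij_betw_same_card)
  then show ?thesis by (simp add: card_cartesian_product card_coord_space)
qed

section \<open>Collisions under a random projection\<close>

definition collisions :: "('b \<Rightarrow> 'c) \<Rightarrow> 'b set \<Rightarrow> ('b \<times> 'b) set" where
  "collisions h S = {(x, x'). x \<in> S \<and> x' \<in> S \<and> x \<noteq> x' \<and> h x = h x'}"

text \<open>Removing the first component of every colliding pair leaves a set on which
  \<open>h\<close> is injective.\<close>

lemma card_le_image_plus_collisions:
  assumes "finite S"
  shows "card S \<le> card (h ` S) + card (collisions h S)"
proof -
  let ?P = "collisions h S"
  have fP: "finite ?P"
    by (rule finite_subset[of _ "S \<times> S"]) (use assms in \<open>auto simp: collisions_def\<close>)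
  have "inj_on h (S - fst ` ?P)"
    by (force simp: inj_on_def collisions_def image_iff)
  then have "card (S - fst ` ?P) \<le> card (h ` S)"
    using assms by (metis card_image card_mono finite_imageI image_mono Diff_subset)
  moreover have "card S \<le> card (S - fst ` ?P) + card (fst ` ?P)"
    using assms fP by (metis card_Un_le card_mono finite_UnI finite_imageI le_trans Un_Diff_cancel2 Un_upper1)
  moreover have "card (fst ` ?P) \<le> card ?P"
    using fP by (rule card_image_le)
  ultimately show ?thesis by linarith
qed

text \<open>Linearity of expectation: each of at most \<open>(card S)\<^sup>2\<close> ordered pairs
  collides for a fraction \<open>1 / q ^ card I\<close> of the matrices.\<close>

lemma sum_collisions_le:
  fixes S :: "('a::{field,finite} ^ 'n) set" and I :: "'m::finite set"
  shows "(\<Sum>A\<in>(coord_matrices I :: ('a ^ 'n ^ 'm) set). real (card (collisions ((*v) A) S)))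
           * real (CARD('a) ^ card I)
         \<le> (real (card S))\<^sup>2 * real (card (coord_matrices I :: ('a ^ 'n ^ 'm) set))"
proof -
  let ?M = "coord_matrices I :: ('a ^ 'n ^ 'm) set"
  let ?Q = "real (CARD('a) ^ card I)"
  let ?D = "{p \<in> S \<times> S. fst p \<noteq> snd p}"
  have "(\<Sum>A\<in>?M. real (card (collisions ((*v) A) S)))
      = (\<Sum>A\<in>?M. \<Sum>p\<in>{p \<in> ?D. A *v fst p = A *v snd p}. 1)"
    by (intro sum.cong) (auto simp: collisions_def intro!: arg_cong[where f = card])
  also have "\<dots> = (\<Sum>p\<in>?D. \<Sum>A\<in>{A \<in> ?M. A *v fst p = A *v snd p}. 1)"
    by (rule sum.swap_restrict) auto
  finally have "(\<Sum>A\<in>?M. real (card (collisions ((*v) A) S))) * ?Q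
      = (\<Sum>p\<in>?D. real (card {A \<in> ?M. A *v fst p = A *v snd p}) * ?Q)"
    by (simp add: sum_distrib_right)
  also have "\<dots> = (\<Sum>p\<in>?D. real (card ?M))"
  proof (rule sum.cong)
    fix p assume p: "p \<in> ?D"
    have "{A \<in> ?M. A *v fst p = A *v snd p} = {A \<in> ?M. A *v (fst p - snd p) = 0}"
      by (auto simp: matrix_vector_mult_diff_distrib)
    then show "real (card {A \<in> ?M. A *v fst p = A *v snd p}) * ?Q = real (card ?M)"
      using card_coord_matrices_kernel[of "fst p - snd p" I] p
      by (metis (mono_tags, lifting) mem_Collect_eq of_nat_mult right_minus_eq)
  qed simp
  also have "\<dots> = real (card ?D) * real (card ?M)" by simp
  also have "\<dots> \<le> (real (card S))\<^sup>2 * real (card ?M)"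
  proof (rule mult_right_mono)
    have "card ?D \<le> card (S \<times> S)" by (rule card_mono) auto
    then have "real (card ?D) \<le> real (card S * card S)"
      by (simp only: card_cartesian_product of_nat_le_iff)
    then show "real (card ?D) \<le> (real (card S))\<^sup>2" by (simp add: power2_eq_square)
  qed simp
  finally show ?thesis .
qed

text \<open>Normalize both collision counts so that each has mean at most 1. If every matrix
  violated one of the bounds, the sum of the two would exceed 2 everywhere, although its mean is at
  most 2.\<close>

lemma ex_coord_matrix_few_collisions:
  fixes S T :: "('a::{field,finite} ^ 'n) set" and I :: "'m::finite set"
  assumes "S \<noteq> {}" "T \<noteq> {}"
  shows "\<exists>A\<in>(coord_matrices I :: ('a ^ 'n ^ 'm) set).
           real (card (collisions ((*v) A) S)) \<le> 2 * (real (card S))\<^sup>2 / real (CARD('a) ^ card I) \<and>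
           real (card (collisions ((*v) A) T)) \<le> 2 * (real (card T))\<^sup>2 / real (CARD('a) ^ card I)"
proof (rule ccontr)
  let ?M = "coord_matrices I :: ('a ^ 'n ^ 'm) set"
  let ?Q = "real (CARD('a) ^ card I)"
  let ?s = "(real (card S))\<^sup>2" and ?t = "(real (card T))\<^sup>2"
  let ?S = "\<lambda>A :: 'a ^ 'n ^ 'm. real (card (collisions ((*v) A) S))"
  let ?T = "\<lambda>A :: 'a ^ 'n ^ 'm. real (card (collisions ((*v) A) T))"
  assume contr: "\<not> ?thesis"
  have s: "?s > 0" and t: "?t > 0" using assms by (auto simp: card_gt_0_iff)
  have Q: "?Q > 0" by simp
  \<comment> \<open>The strict inequality between sums needs a nonempty index set.\<close>
  have M: "0 \<in> ?M" by (simp add: coord_matrices_def)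
  have "2 < ?S A * ?Q / ?s + ?T A * ?Q / ?t" if A: "A \<in> ?M" for A
  proof -
    have "2 * ?s / ?Q < ?S A \<or> 2 * ?t / ?Q < ?T A"
      using contr A by (meson not_le)
    then have "2 < ?S A * ?Q / ?s \<or> 2 < ?T A * ?Q / ?t"
      using s t Q by (simp add: field_simps)
    moreover have "0 \<le> ?S A * ?Q / ?s" "0 \<le> ?T A * ?Q / ?t" by simp_all
    ultimately show ?thesis by linarith
  qed
  then have "(\<Sum>A\<in>?M. 2) < (\<Sum>A\<in>?M. ?S A * ?Q / ?s + ?T A * ?Q / ?t)"
    using M by (intro sum_strict_mono) auto
  also have "\<dots> = (\<Sum>A\<in>?M. ?S A) * ?Q / ?s + (\<Sum>A\<in>?M. ?T A) * ?Q / ?t"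
    by (simp only: sum.distrib sum_distrib_right sum_divide_distrib)
  also have "\<dots> \<le> real (card ?M) + real (card ?M)"
  proof (rule add_mono)
    show "(\<Sum>A\<in>?M. ?S A) * ?Q / ?s \<le> real (card ?M)"
      using sum_collisions_le[where I = I and S = S] s by (simp add: pos_divide_le_eq mult.commute)
    show "(\<Sum>A\<in>?M. ?T A) * ?Q / ?t \<le> real (card ?M)"
      using sum_collisions_le[where I = I and S = T] t by (simp add: pos_divide_le_eq mult.commute)
  qed
  finally show False by simp
qed

section \<open>Radial projections under linear maps, and covering by lines\<close>

lemma card_blocks_le_card_radial_proj:
  fixes A :: "'a::{field,finite} ^ 'n ^ 'm"
  assumes y: "A *v y \<notin> (*v) A ` E"
  shows "card {L \<in> {param_line b a | a b. P a b}. A *v y \<in> L \<and> (*v) A ` E \<inter> L \<noteq> {}}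
           \<le> card (radial_proj y E)"
proof -
  have "{L \<in> {param_line b a | a b. P a b}. A *v y \<in> L \<and> (*v) A ` E \<inter> L \<noteq> {}}
      \<subseteq> (\<lambda>L. (*v) A ` L) ` radial_proj y E"
  proof
    fix L assume "L \<in> {L \<in> {param_line b a | a b. P a b}. A *v y \<in> L \<and> (*v) A ` E \<inter> L \<noteq> {}}"
    then obtain a b x where L: "L = param_line b a" "A *v y \<in> L" "x \<in> E" "A *v x \<in> L"
      by blast
    \<comment> \<open>Since the two images differ, the line through \<open>x\<close> and
      \<open>y\<close> does not collapse, and its image is the only line through them, namely
      \<open>L\<close>.\<close>
    have ne: "A *v x \<noteq> A *v y" using L(3) y by (metis imageI)
    then have "x \<noteq> y" by auto
    then have "line_proj y x \<in> radial_proj y E"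
      using L(3) by (auto simp: radial_proj_def)
    moreover have "L = (*v) A ` line_proj y x"
      using param_line_unique[of "A *v x" b a "A *v y"] L ne
      by (simp add: line_proj_eq[OF \<open>x \<noteq> y\<close>] matrix_image_param_line)
    ultimately show "L \<in> (\<lambda>L. (*v) A ` L) ` radial_proj y E" by blast
  qed
  then show ?thesis
    by (rule surj_card_le[rotated]) simp
qed

lemma card_le_card_radial_proj:
  fixes E :: "('a::{field,finite} ^ 'n) set"
  assumes "y \<notin> E"
  shows "card E \<le> CARD('a) * card (radial_proj y E)"
proof -
  have "E \<subseteq> \<Union> (radial_proj y E)"
  proof
    fix x assume "x \<in> E"
    then have "x \<noteq> y" and "line_proj y x \<in> radial_proj y E"
      using assms by (auto simp: radial_proj_def)
    then show "x \<in> \<Union> (radial_proj y E)"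
      using line_proj_eq right_mem_param_line by (metis UnionI)
  qed
  then have "card E \<le> card (\<Union> (radial_proj y E))"
    by (intro card_mono) auto
  also have "\<dots> \<le> (\<Sum>L\<in>radial_proj y E. card L)"
    using card_Union_le_sum_card by simp
  also have "\<dots> = (\<Sum>L\<in>radial_proj y E. CARD('a))"
    using assms by (intro sum.cong) (auto simp: radial_proj_def, metis line_proj_eq card_param_line)
  finally show ?thesis by (simp add: mult.commute)
qed

section \<open>Reduction to dimension \<open>k + 1\<close> and conclusion\<close>

theorem theorem1p1:
  fixes E :: "('a::{field,finite} ^ 'd) set" and q d k :: nat
  assumes q: "q = CARD('a)"
    and d: "d = CARD('d)"
    and k: "k \<in> {1..d - 1}"
    and E: "real q ^ (k - 1) \<le> real (card E)" "real (card E) \<le> real q ^ k / 100"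
  shows "real (card {y :: 'a ^ 'd. real (card (radial_proj y E)) \<le> real (card E) / 50})
           \<le> 40 * real q ^ k"
proof (rule ccontr)
  let ?T = "{y :: 'a ^ 'd. real (card (radial_proj y E)) \<le> real (card E) / 50}"
  assume "\<not> ?thesis"
  then have big: "40 * real q ^ k < real (card ?T)" by simp
  have q0: "q > 0" unfolding q by simp
  have "0 < real q ^ (k - 1)" using q0 by simp
  then have E0: "card E > 0" using E(1) by linarith
  have qk: "0 < real q ^ k" using q0 by simp
  have "card ?T \<le> card (?T - E) + card E"
    using card_Un_le[of "?T - E" E] card_mono[of "(?T - E) \<union> E" ?T] by force
  then have TE: "39 * real q ^ k < real (card (?T - E))"
    using big E(2) qk by linarith
  \<comment> \<open>The collision bound is quadratic in the size of the set, so a subset of size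
    comparable to \<open>q ^ k\<close> replaces the whole exceptional set. The constant 10 is large
    enough for \<open>5 * q ^ k\<close> points to survive below.\<close>
  then have "10 * q ^ k \<le> card (?T - E)"
    using qk by (simp flip: of_nat_le_iff[where ?'a = real])
  then obtain F where F: "F \<subseteq> ?T - E" "card F = 10 * q ^ k"
    by (rule obtain_subset_with_card_n)
  have F0: "F \<noteq> {}" using F(2) q0 by auto
  \<comment> \<open>A projection from a point outside \<open>E\<close> has at least
    \<open>card E / q\<close> lines, but here at most \<open>card E / 50\<close>.\<close>
  have q50: "50 \<le> real q"
  proof -
    obtain y where "y \<in> F" using F0 by blast
    then have "y \<notin> E" and low: "real (card (radial_proj y E)) \<le> real (card E) / 50"
      using F(1) by auto
    have "real (card E) \<le> real q * real (card (radial_proj y E))"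
      using card_le_card_radial_proj[OF \<open>y \<notin> E\<close>] by (metis q of_nat_le_iff of_nat_mult)
    also have "\<dots> \<le> real q * (real (card E) / 50)"
      by (intro mult_left_mono low) simp
    finally show ?thesis using E0 by (simp add: field_simps)
  qed
  have "k + 1 \<le> card (UNIV :: 'd set)" using k unfolding d by auto
  then obtain I :: "'d set" where I: "card I = k + 1"
    by (rule obtain_subset_with_card_n)
  then have I0: "I \<noteq> {}" by auto
  let ?W = "coord_space I :: ('a ^ 'd) set"
  let ?B = "{param_line y x | x y. x \<in> ?W \<and> y \<in> ?W \<and> x \<noteq> y}"
  interpret W: finite_linear_space ?W ?B q
    unfolding q by (rule finite_linear_space_coord_space[OF I0])
  obtain A :: "'a ^ 'd ^ 'd" where A: "A \<in> coord_matrices I"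
    and cE: "real (card (collisions ((*v) A) E)) \<le> 2 * (real (card E))\<^sup>2 / real (q ^ (k + 1))"
    and cF: "real (card (collisions ((*v) A) F)) \<le> 2 * (real (card F))\<^sup>2 / real (q ^ (k + 1))"
    using ex_coord_matrix_few_collisions[of E F I] E0 F0
    unfolding q[symmetric] I by (metis card_gt_0_iff)
  let ?E = "(*v) A ` E" and ?F = "(*v) A ` F - (*v) A ` E"
  have cardW: "real (card ?W) = real q ^ (k + 1)"
    using card_coord_space[of I, where ?'a = 'a] by (simp add: I q)
  have E'_le: "real (card ?E) \<le> real (card E)" by (simp add: card_image_le)
  \<comment> \<open>Collisions cost at most \<open>card E / 2500\<close>, well within the permitted
    loss of \<open>card E / 50\<close>. This turns the threshold \<open>card E / 50\<close> into the
    bound with factor 49 relative to the image.\<close>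
  have E'_ge: "49 * real (card E) \<le> 50 * real (card ?E)"
  proof -
    have "2 * (real (card E))\<^sup>2 / real (q ^ (k + 1))
        = 2 * real (card E) / real q * (real (card E) / real q ^ k)"
      by (simp add: power2_eq_square)
    also have "\<dots> \<le> 2 * real (card E) / 50 * (1 / 100)"
      using E(2) q50 qk by (intro mult_mono divide_left_mono) (auto simp: field_simps)
    finally have "real (card (collisions ((*v) A) E)) \<le> real (card E) / 2500"
      using cE by simp
    moreover have "real (card E) \<le> real (card ?E) + real (card (collisions ((*v) A) E))"
      using card_le_image_plus_collisions[of E "(*v) A"]
      by (metis finite of_nat_add of_nat_le_iff)
    ultimately show ?thesis by linarith
  qed
  \<comment> \<open>Of \<open>10 * q ^ k\<close> points, collisions cost at most
    \<open>200 * q ^ k / q \<le> 4 * q ^ k\<close>, and removing the image of \<open>E\<close> at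
    most \<open>q ^ k / 100\<close>.\<close>
  have F'_ge: "5 * real q ^ k \<le> real (card ?F)"
  proof -
    have "2 * (real (card F))\<^sup>2 / real (q ^ (k + 1)) = 200 * real q ^ k / real q"
      using q0 by (simp add: F(2) power2_eq_square)
    also have "\<dots> \<le> 200 * real q ^ k / 50"
      using q50 by (intro divide_left_mono) auto
    finally have "real (card (collisions ((*v) A) F)) \<le> 4 * real q ^ k"
      using cF by simp
    moreover have "real (card F) \<le> real (card ((*v) A ` F)) + real (card (collisions ((*v) A) F))"
      using card_le_image_plus_collisions[of F "(*v) A"]
      by (metis finite of_nat_add of_nat_le_iff)
    moreover have "real (card ((*v) A ` F)) - real (card ?E) \<le> real (card ?F)"
      using diff_card_le_card_Diff[of ?E "(*v) A ` F"] by simp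
    ultimately show ?thesis using E'_le E(2) qk F(2) by simp
  qed
  have "real (card ?F) \<le> 2 * W.repl"
  proof (rule W.card_low_projection_points)
    show "?E \<subseteq> ?W" using coord_matrices_mult[OF A] by auto
    show "?E \<noteq> {}" using E0 by auto
    have "real q * real (card ?E) \<le> real q * (real q ^ k / 100)"
      using E'_le E(2) by (intro mult_left_mono) auto
    then show "100 * (real q * real (card ?E)) \<le> real (card ?W)"
      by (simp add: cardW)
    show "?F \<subseteq> ?W - ?E" using coord_matrices_mult[OF A] by auto
  next
    fix y' assume "y' \<in> ?F"
    then obtain y where y: "y \<in> F" "y' = A *v y" "A *v y \<notin> ?E" by blast
    have "real (card {L \<in> ?B. y' \<in> L \<and> ?E \<inter> L \<noteq> {}}) \<le> real (card (radial_proj y E))"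
      unfolding y(2) of_nat_le_iff
      by (rule card_blocks_le_card_radial_proj[OF y(3), of "\<lambda>x y. x \<in> ?W \<and> y \<in> ?W \<and> x \<noteq> y"])
    also have "\<dots> \<le> real (card E) / 50" using y(1) F(1) by auto
    finally show "49 * real (card {L \<in> ?B. y' \<in> L \<and> ?E \<inter> L \<noteq> {}}) \<le> real (card ?E)"
      using E'_ge by linarith
  qed
  \<comment> \<open>Here \<open>repl\<close> is \<open>(q ^ (k + 1) - 1) / (q - 1)\<close>. The
    resulting upper bound \<open>4 * q ^ k\<close> contradicts the lower bound
    \<open>5 * q ^ k\<close>.\<close>
  also have "W.repl \<le> 2 * real q ^ k"
  proof -
    have h: "2 * real q ^ k \<le> real q * real q ^ k"
      using q50 by (intro mult_right_mono) auto
    show ?thesis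
      unfolding W.repl_def cardW using q50 by (simp add: field_simps) (use h in linarith)
  qed
  finally show False using F'_ge qk by linarith
qed

end
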